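(* Let $N$ be a positive integer, $\Omega=\{-1,+1\}^N$, and let $(Y_k)_{k\ge1}$ be the Wolff dynamics on $\Omega$ at $\hat J=+\infty$. Then, from any initial configuration, the chain reaches the set $\{-\mathbf 1,+\mathbf 1\}$ in finitely many steps almost surely, and once it enters $\{-\mathbf 1,+\mathbf 1\}$ it remains in this set thereafter. More precisely, if the initial configuration satisfies $Y_1\in\{-\mathbf 1,+\mathbf 1\}$, then for any $k\ge1$ (almost surely) $$Y_k=\begin{cases}Y_1,& k\text{ odd},\\ -Y_1,& k\text{ even}.\end{cases}$$ Furthermore, for any initial configuration $\tilde\sigma\in\Omega$ with $\tilde\sigma\notin\{-\mathbf 1,+\mathbf 1\}$, $$\mathbb P\big(Y_{\tilde{\mathcal C}^{\tilde\sigma}+1}\in\{-\mathbf 1,+\mathbf 1\}\mid Y_1=\tilde\sigma\big)=1,$$ and consequently, for any $k\ge0$, $$\mathbb P\big(Y_{\tilde{\mathcal C}^{\tilde\sigma}+1+k}\in\{-\mathbf 1,+\mathbf 1\}\mid Y_1=\tilde\sigma\big)=1.$$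
   Context: $\mathbf 1=(1,\dots,1)^T\in\mathbb R^N$. $G$ is the undirected cycle on $[N]=\{1,\dots,N\}$ with edges $\{i,i+1\}$, $i=1,\dots,N$, indices cyclic ($N+1\equiv1$). Wolff dynamics with coupling constant $\hat J$: one step from $\sigma\in\Omega$ is as follows. Choose a site $i_0\in[N]$ uniformly at random and start the cluster with $i_0$. Repeatedly, for each site $i$ in the cluster and each edge joining $i$ to a neighbour $j$ with $\sigma_j=\sigma_i$ such that this edge has not been considered before, add $j$ to the cluster with probability $1-e^{-2\hat J}$, independently over edges. When no edge remains to be considered, flip all spins of the cluster. For $\hat J=+\infty$ the addition probability is $1$, so one step chooses $i_0$ uniformly and flips the whole maximal connected set of sites containing $i_0$ on which $\sigma$ is constant. For $\sigma\in\Omega$, $\tilde{\mathcal C}^\sigma$ is the number of connected components in $G$ of the set $\mathcal C^\sigma=\{k\in[N]:\sigma_k=+1\}$. (For $\sigma\notin\{-\mathbf1,+\mathbf1\}$ it equals the number of connected components of $\{k:\sigma_k=-1\}$.) *)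

theory Defs
  imports "HOL-Probability.Probability"
begin

definition spin_configs :: "nat \<Rightarrow> (nat \<Rightarrow> int) set" where
  "spin_configs N = {1..N} \<rightarrow>\<^sub>E {-1, 1}"

definition all_plus :: "nat \<Rightarrow> nat \<Rightarrow> int" where
  "all_plus N = (\<lambda>i\<in>{1..N}. 1)"

definition spin_neg :: "nat \<Rightarrow> (nat \<Rightarrow> int) \<Rightarrow> nat \<Rightarrow> int" where
  "spin_neg N \<sigma> = (\<lambda>i\<in>{1..N}. - \<sigma> i)"

definition all_minus :: "nat \<Rightarrow> nat \<Rightarrow> int" where
  "all_minus N = spin_neg N (all_plus N)"

definition cyclic_succ :: "nat \<Rightarrow> nat \<Rightarrow> nat" where
  "cyclic_succ N i = (if i = N then 1 else i + 1)"

text \<open>Edges are unordered pairs; for \<open>N = 1\<close> the only edge degenerates to the loop \<open>{1}\<close>,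
  and for \<open>N = 2\<close> the two cyclic edges coincide.\<close>

definition cycle_edges :: "nat \<Rightarrow> nat set set" where
  "cycle_edges N = {{i, cyclic_succ N i} |i. i \<in> {1..N}}"

definition components :: "nat \<Rightarrow> nat set \<Rightarrow> nat set set" where
  "components N A = A // {(i, j). i \<in> A \<and> j \<in> A \<and> {i, j} \<in> cycle_edges N}\<^sup>*"

definition plus_components :: "nat \<Rightarrow> (nat \<Rightarrow> int) \<Rightarrow> nat" where
  "plus_components N \<sigma> = card (components N {k \<in> {1..N}. \<sigma> k = 1})"

definition open_pairs ::
    "nat \<Rightarrow> (nat \<Rightarrow> int) \<Rightarrow> nat set \<Rightarrow> nat set set \<Rightarrow> (nat \<times> nat) set" where
  "open_pairs N \<sigma> C F =
     {(i, j). i \<in> C \<and> {i, j} \<in> cycle_edges N \<and> \<sigma> j = \<sigma> i \<and> {i, j} \<notin> F}"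

text \<open>Cluster exploration with addition probability \<open>p\<close>: \<open>C\<close> is the cluster found so far and \<open>F\<close>
  the set of edges already considered.  The order in which edges are considered does not affect
  the law of the final cluster; it is fixed here by choice.\<close>

function wolff_cluster ::
    "nat \<Rightarrow> real \<Rightarrow> (nat \<Rightarrow> int) \<Rightarrow> nat set \<Rightarrow> nat set set \<Rightarrow> nat set pmf" where
  "wolff_cluster N p \<sigma> C F =
     (if open_pairs N \<sigma> C F = {} then return_pmf C
      else let (i, j) = (SOME e. e \<in> open_pairs N \<sigma> C F) in
        bind_pmf (bernoulli_pmf p)
          (\<lambda>b. wolff_cluster N p \<sigma> (if b then insert j C else C) (insert {i, j} F)))"
  by pat_completeness auto
termination
proof (relation "Wellfounded.measure (\<lambda>(N, p, \<sigma>, C, F). card (cycle_edges N - F))", simp, clarify)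
  fix N :: nat and p :: real and \<sigma> :: "nat \<Rightarrow> int" and C F i j b
  assume ne: "open_pairs N \<sigma> C F \<noteq> {}" and ij: "(i, j) = (SOME e. e \<in> open_pairs N \<sigma> C F)"
  have "(i, j) \<in> open_pairs N \<sigma> C F"
    unfolding ij using ne by (simp add: some_in_eq)
  then have e: "{i, j} \<in> cycle_edges N - F"
    by (auto simp: open_pairs_def)
  have "cycle_edges N = (\<lambda>i. {i, cyclic_succ N i}) ` {1..N}"
    by (auto simp: cycle_edges_def)
  then have "finite (cycle_edges N - F)"
    by simp
  then have "card (cycle_edges N - insert {i, j} F) < card (cycle_edges N - F)"
    using e by (intro psubset_card_mono) auto
  then show "((N, p, \<sigma>, if b then insert j C else C, insert {i, j} F), N, p, \<sigma>, C, F)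
      \<in> Wellfounded.measure (\<lambda>(N, p, \<sigma>, C, F). card (cycle_edges N - F))"
    by simp
qed

declare wolff_cluster.simps [simp del]

text \<open>The addition probability \<open>1 - exp (-2 J)\<close>, with its limiting value at \<open>J = \<infinity>\<close>;
  meant for \<open>J \<ge> 0\<close>.\<close>

definition add_prob :: "ereal \<Rightarrow> real" where
  "add_prob J = (if J = \<infinity> then 1 else 1 - exp (- 2 * real_of_ereal J))"

definition wolff_step :: "nat \<Rightarrow> ereal \<Rightarrow> (nat \<Rightarrow> int) \<Rightarrow> (nat \<Rightarrow> int) pmf" where
  "wolff_step N J \<sigma> =
     bind_pmf (pmf_of_set {1..N}) (\<lambda>i\<^sub>0.
       map_pmf (\<lambda>C. \<lambda>i\<in>{1..N}. if i \<in> C then - \<sigma> i else \<sigma> i)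
         (wolff_cluster N (add_prob J) \<sigma> {i\<^sub>0} {}))"

text \<open>Time-homogeneous Markov chains with countable state space \<open>S\<close>, transition law \<open>K\<close> and
  times \<open>k \<ge> 1\<close>; the law of \<open>Y 1\<close> is arbitrary, and \<open>Y 0\<close> plays no role.\<close>

locale markov_chain = prob_space M
  for M :: "'w measure" +
  fixes S :: "'s set" and K :: "'s \<Rightarrow> 's pmf" and Y :: "nat \<Rightarrow> 'w \<Rightarrow> 's"
  assumes random_state: "k \<ge> 1 \<Longrightarrow> random_variable (count_space S) (Y k)"
    and markov: "k \<ge> 1 \<Longrightarrow> \<P>(\<omega> in M. \<forall>i\<in>{1..k}. Y i \<omega> = x i) > 0 \<Longrightarrow>
      \<P>(\<omega> in M. Y (k + 1) \<omega> = x (k + 1) \<bar> \<forall>i\<in>{1..k}. Y i \<omega> = x i) = pmf (K (x k)) (x (k + 1))"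

definition wolff_dynamics ::
    "nat \<Rightarrow> ereal \<Rightarrow> 'w measure \<Rightarrow> (nat \<Rightarrow> 'w \<Rightarrow> nat \<Rightarrow> int) \<Rightarrow> bool" where
  "wolff_dynamics N J M Y \<longleftrightarrow> markov_chain M (spin_configs N) (wolff_step N J) Y"

end

theory Submission
  imports Defs
begin

text \<open>At infinite coupling every edge joining equal spins is accepted, so the cluster is the whole
  same-spin component of the chosen site, whatever the order of exploration
  (\<open>wolff_cluster_full\<close>).  The quantity that controls the dynamics is the number of plus runs,
  measured by their clockwise ends: the sites carrying \<open>+1\<close> whose successor carries \<open>-1\<close>.

  On a non-constant configuration a step absorbs a whole run of some spin \<open>s\<close> into its surroundings.
  No new end of an \<open>s\<close>-run can appear, since a cluster has no neighbour of its own spin outside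
  itself, and the end of the absorbed run disappears (\<open>flip_run_ends_psubset\<close>).  Going once around
  the cycle, the spin changes from \<open>+1\<close> to \<open>-1\<close> as often as back, so plus runs and minus runs have
  equally many ends (\<open>card_run_ends_eq\<close>), and the number of plus ends drops whichever kind of run was
  absorbed.  It vanishes exactly on the two constant configurations, and there the
  cluster is everything, so a step is the global spin flip.  Distinct plus ends lie in distinct plus
  components (\<open>card_run_ends_le_plus_components\<close>), so at most as many steps as there are plus
  components are needed.

  All of this concerns the support of one step.  It transfers to the chain because almost every
  trajectory uses only transitions of positive probability (\<open>AE_transitions\<close>).\<close>

section \<open>The cluster at acceptance probability one\<close>

definition same_spin_edges :: "nat \<Rightarrow> (nat \<Rightarrow> int) \<Rightarrow> (nat \<times> nat) set" where
  "same_spin_edges N \<sigma> = {(i, j). {i, j} \<in> cycle_edges N \<and> \<sigma> j = \<sigma> i}"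

lemma bernoulli_pmf_1: "bernoulli_pmf 1 = return_pmf True"
proof (rule pmf_eqI)
  show "pmf (bernoulli_pmf 1) b = pmf (return_pmf True) b" for b
    by (cases b) simp_all
qed

text \<open>The requirement on \<open>F\<close> is the invariant of the exploration: with certain acceptance, an edge
  that has been considered has both endpoints in the cluster.  So when no pair is left to consider,
  the cluster is closed under same-spin edges.\<close>

lemma wolff_cluster_full:
  assumes "\<forall>e\<in>F. e \<subseteq> C"
  shows "wolff_cluster N 1 \<sigma> C F = return_pmf ((same_spin_edges N \<sigma>)\<^sup>* `` C)"
proof -
  \<comment> \<open>The acceptance probability has to be a variable for the induction over the exploration.\<close>
  have "p = 1 \<Longrightarrow> \<forall>e\<in>F. e \<subseteq> C \<Longrightarrow>
      wolff_cluster N p \<sigma> C F = return_pmf ((same_spin_edges N \<sigma>)\<^sup>* `` C)" for p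
  proof (induction N p \<sigma> C F rule: wolff_cluster.induct)
    case (1 N p \<sigma> C F)
    let ?R = "same_spin_edges N \<sigma>"
    show ?case
    proof (cases "open_pairs N \<sigma> C F = {}")
      case True
      have "?R `` C \<subseteq> C"
      proof clarify
        fix i j assume "i \<in> C" and "(i, j) \<in> ?R"
        then have "{i, j} \<in> F"
          using True by (auto simp: open_pairs_def same_spin_edges_def)
        then show "j \<in> C"
          using 1(3) by blast
      qed
      then have "?R\<^sup>* `` C = C"
        by (rule Image_closed_trancl)
      with True show ?thesis
        by (subst wolff_cluster.simps) simp
    next
      case False
      obtain i j where ij: "(i, j) = (SOME e. e \<in> open_pairs N \<sigma> C F)"
        by (metis surj_pair)
      have mem: "(i, j) \<in> open_pairs N \<sigma> C F"
        unfolding ij using False by (simp add: some_in_eq)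
      then have iC: "i \<in> C" and R: "(i, j) \<in> ?R"
        by (auto simp: open_pairs_def same_spin_edges_def)
      have "wolff_cluster N p \<sigma> C F = wolff_cluster N p \<sigma> (insert j C) (insert {i, j} F)"
        using False 1(2)
        by (subst wolff_cluster.simps)
          (simp add: ij[symmetric] bernoulli_pmf_1 bind_return_pmf)
      also have "\<dots> = return_pmf (?R\<^sup>* `` insert j C)"
        using 1(1)[OF False refl ij, of True] 1(2,3) iC
        by (auto simp: bernoulli_pmf_1)
      also have "?R\<^sup>* `` insert j C = ?R\<^sup>* `` C"
        using iC R by (auto intro: converse_rtrancl_into_rtrancl)
      finally show ?thesis .
    qed
  qed
  with assms show ?thesis
    by simp
qed

definition flip_cluster :: "nat \<Rightarrow> (nat \<Rightarrow> int) \<Rightarrow> nat \<Rightarrow> nat \<Rightarrow> int" where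
  "flip_cluster N \<sigma> i\<^sub>0 =
     (\<lambda>i\<in>{1..N}. if i \<in> (same_spin_edges N \<sigma>)\<^sup>* `` {i\<^sub>0} then - \<sigma> i else \<sigma> i)"

lemma set_pmf_wolff_step:
  assumes "N \<ge> 1"
  shows "set_pmf (wolff_step N \<infinity> \<sigma>) = flip_cluster N \<sigma> ` {1..N}"
  using assms
  by (auto simp: wolff_step_def add_prob_def wolff_cluster_full flip_cluster_def)

lemma spin_cases:
  assumes "\<sigma> \<in> spin_configs N" and "i \<in> {1..N}"
  shows "\<sigma> i = 1 \<or> \<sigma> i = -1"
  using PiE_mem[OF assms[unfolded spin_configs_def]] by auto

lemma cluster_spin:
  assumes "(i, j) \<in> (same_spin_edges N \<sigma>)\<^sup>*"
  shows "\<sigma> j = \<sigma> i"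
  using assms by induction (auto simp: same_spin_edges_def)

section \<open>Walking around the cycle\<close>

lemma cyclic_succ_in: "i \<in> {1..N} \<Longrightarrow> cyclic_succ N i \<in> {1..N}"
  by (auto simp: cyclic_succ_def)

lemma edge_cyclic_succ:
  assumes "i \<in> {1..N}"
  shows "{i, cyclic_succ N i} \<in> cycle_edges N"
  using assms by (auto simp: cycle_edges_def)

lemma bij_betw_cyclic_succ: "bij_betw (cyclic_succ N) {1..N} {1..N}"
proof -
  have "inj_on (cyclic_succ N) {1..N}"
    by (auto simp: inj_on_def cyclic_succ_def split: if_splits)
  moreover have "cyclic_succ N ` {1..N} \<subseteq> {1..N}"
    using cyclic_succ_in by blast
  ultimately show ?thesis
    by (simp add: bij_betw_def endo_inj_surj)
qed

lemma cyclic_induct [consumes 2, case_names start step]: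
  assumes "x \<in> {1..N}" and "y \<in> {1..N}" and "P x"
    and step: "\<And>z. z \<in> {1..N} \<Longrightarrow> P z \<Longrightarrow> P (cyclic_succ N z)"
  shows "P y"
proof -
  have up: "P b" if "P a" "a \<le> b" "1 \<le> a" "b \<le> N" for a b
    using that(2,1,3,4)
  proof (induction rule: dec_induct)
    case (step n)
    then show ?case
      using assms(4)[of n] by (simp add: cyclic_succ_def)
  qed
  have "P N"
    using up[of x N] assms by simp
  then have "P 1"
    using step[of N] assms(1) by (simp add: cyclic_succ_def)
  then show "P y"
    using up[of 1 y] assms(2) by simp
qed

section \<open>Ends of runs\<close>

definition run_ends :: "nat \<Rightarrow> int \<Rightarrow> (nat \<Rightarrow> int) \<Rightarrow> nat set" where
  "run_ends N s \<sigma> = {i \<in> {1..N}. \<sigma> i = s \<and> \<sigma> (cyclic_succ N i) \<noteq> s}"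

lemma finite_run_ends [simp]: "finite (run_ends N s \<sigma>)"
  by (simp add: run_ends_def)

text \<open>The sites with spin \<open>+1\<close> and the sites whose successor has spin \<open>+1\<close> are equally many because
  the successor permutes the cycle; the two kinds of ends are the two differences of these sets.\<close>

lemma card_run_ends_eq:
  assumes "\<sigma> \<in> spin_configs N"
  shows "card (run_ends N (-1) \<sigma>) = card (run_ends N 1 \<sigma>)"
proof -
  let ?A = "{i \<in> {1..N}. \<sigma> i = 1}"
  let ?B = "{i \<in> {1..N}. \<sigma> (cyclic_succ N i) = 1}"
  have spin: "\<sigma> i = 1 \<or> \<sigma> i = -1" if "i \<in> {1..N}" for i
    using spin_cases[OF assms that] .
  have "bij_betw (cyclic_succ N) ?B (cyclic_succ N ` ?B)"
    by (rule bij_betw_subset[OF bij_betw_cyclic_succ[of N]]) auto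
  moreover have "cyclic_succ N ` ?B = ?A"
  proof -
    have "cyclic_succ N ` ?B = {i \<in> cyclic_succ N ` {1..N}. \<sigma> i = 1}"
      by blast
    then show ?thesis
      by (simp only: bij_betw_imp_surj_on[OF bij_betw_cyclic_succ])
  qed
  ultimately have "bij_betw (cyclic_succ N) ?B ?A"
    by simp
  then have AB: "card ?B = card ?A"
    by (rule bij_betw_same_card)
  have "run_ends N 1 \<sigma> = ?A - ?B"
    by (auto simp: run_ends_def)
  moreover have "(\<sigma> i = -1 \<and> \<sigma> (cyclic_succ N i) \<noteq> -1) = (\<sigma> (cyclic_succ N i) = 1 \<and> \<sigma> i \<noteq> 1)"
    if "i \<in> {1..N}" for i
    using spin[OF that] spin[OF cyclic_succ_in[OF that]] by auto
  then have "run_ends N (-1) \<sigma> = ?B - ?A"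
    by (auto simp: run_ends_def)
  ultimately show ?thesis
    using AB by (simp add: card_Diff_subset_Int Int_commute)
qed

lemma run_ends_constant:
  assumes "\<forall>i\<in>{1..N}. \<sigma> i = s"
  shows "run_ends N t \<sigma> = {}"
proof -
  have "\<sigma> (cyclic_succ N i) = \<sigma> i" if "i \<in> {1..N}" for i
    using assms that cyclic_succ_in[OF that] by simp
  then show ?thesis
    by (auto simp: run_ends_def)
qed

lemma constant_config_iff:
  assumes "\<sigma> \<in> spin_configs N"
  shows "\<sigma> \<in> {all_minus N, all_plus N} \<longleftrightarrow> (\<exists>s. \<forall>i\<in>{1..N}. \<sigma> i = s)"
proof
  assume "\<sigma> \<in> {all_minus N, all_plus N}"
  then show "\<exists>s. \<forall>i\<in>{1..N}. \<sigma> i = s"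
    by (auto simp: all_minus_def all_plus_def spin_neg_def)
next
  assume "\<exists>s. \<forall>i\<in>{1..N}. \<sigma> i = s"
  then obtain s where s: "\<forall>i\<in>{1..N}. \<sigma> i = s"
    by blast
  have ext: "\<sigma> \<in> extensional {1..N}"
    using assms by (auto simp: spin_configs_def PiE_def)
  have spin: "\<sigma> i = 1 \<or> \<sigma> i = -1" if "i \<in> {1..N}" for i
    using spin_cases[OF assms that] .
  show "\<sigma> \<in> {all_minus N, all_plus N}"
  proof (cases "s = 1")
    case True
    have "\<sigma> = all_plus N"
      using ext s True
      by (intro extensionalityI[of _ "{1..N}"]) (auto simp: all_plus_def)
    then show ?thesis by simp
  next
    case False
    have "\<sigma> = all_minus N"
      using ext s False spin
      by (intro extensionalityI[of _ "{1..N}"]) (force simp: all_minus_def spin_neg_def all_plus_def)+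
    then show ?thesis by simp
  qed
qed

lemma no_run_ends_iff_constant:
  assumes "\<sigma> \<in> spin_configs N"
  shows "run_ends N 1 \<sigma> = {} \<longleftrightarrow> \<sigma> \<in> {all_minus N, all_plus N}"
proof
  assume "\<sigma> \<in> {all_minus N, all_plus N}"
  then show "run_ends N 1 \<sigma> = {}"
    unfolding constant_config_iff[OF assms] using run_ends_constant by blast
next
  assume empty: "run_ends N 1 \<sigma> = {}"
  have spin: "\<sigma> i = 1 \<or> \<sigma> i = -1" if "i \<in> {1..N}" for i
    using spin_cases[OF assms that] .
  have "\<exists>s. \<forall>i\<in>{1..N}. \<sigma> i = s"
  proof (cases "\<exists>x\<in>{1..N}. \<sigma> x = 1")
    case True
    then obtain x where x: "x \<in> {1..N}" "\<sigma> x = 1"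
      by blast
    have "\<sigma> y = 1" if "y \<in> {1..N}" for y
      using x(1) that
    proof (induction rule: cyclic_induct)
      case (step z)
      then show ?case using empty by (auto simp: run_ends_def)
    qed (fact x(2))
    then show ?thesis by blast
  next
    case False
    then show ?thesis using spin by blast
  qed
  then show "\<sigma> \<in> {all_minus N, all_plus N}"
    unfolding constant_config_iff[OF assms] .
qed

text \<open>From an end, a path through plus sites can only go backwards, because the way forward is blocked
  by a minus site.  So every site of the component of an end \<open>r\<close> leads forward to \<open>r\<close> through plus
  sites, and a site that is itself an end can do so only by being \<open>r\<close>.\<close>

lemma card_run_ends_le_plus_components:
  "card (run_ends N 1 \<sigma>) \<le> plus_components N \<sigma>"
proof -
  let ?A = "{k \<in> {1..N}. \<sigma> k = 1}"
  let ?S = "{(i, j). i \<in> ?A \<and> j \<in> ?A \<and> {i, j} \<in> cycle_edges N}"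
  let ?T = "{(i, j). i \<in> ?A \<and> j \<in> ?A \<and> j = cyclic_succ N i}"
  have backward: "(x, r) \<in> ?T\<^sup>*" if "(r, x) \<in> ?S\<^sup>*" and r: "r \<in> run_ends N 1 \<sigma>" for r x
    using that(1)
  proof (induction rule: rtrancl_induct)
    case (step y z)
    have yz: "y \<in> ?A" "z \<in> ?A"
      using step.hyps(2) by auto
    have "y = cyclic_succ N z \<or> z = cyclic_succ N y"
      using step.hyps(2) by (auto simp: cycle_edges_def doubleton_eq_iff)
    then show ?case
    proof
      assume "y = cyclic_succ N z"
      then have "(z, y) \<in> ?T"
        using yz by simp
      then show ?thesis
        using step.IH by (rule converse_rtrancl_into_rtrancl)
    next
      assume z: "z = cyclic_succ N y"
      show ?thesis
        using step.IH
      proof (cases rule: converse_rtranclE)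
        case base
        then show ?thesis using r z yz by (simp add: run_ends_def)
      next
        case (step w)
        then show ?thesis using z by simp
      qed
    qed
  qed simp
  have "inj_on (\<lambda>r. ?S\<^sup>* `` {r}) (run_ends N 1 \<sigma>)"
  proof (rule inj_onI)
    fix r r'
    assume r: "r \<in> run_ends N 1 \<sigma>" and r': "r' \<in> run_ends N 1 \<sigma>"
      and "?S\<^sup>* `` {r} = ?S\<^sup>* `` {r'}"
    then have "(r, r') \<in> ?S\<^sup>*"
      by blast
    then have "(r', r) \<in> ?T\<^sup>*"
      using backward r by blast
    then show "r = r'"
      by (cases rule: converse_rtranclE) (use r' in \<open>auto simp: run_ends_def\<close>)
  qed
  moreover have "(\<lambda>r. ?S\<^sup>* `` {r}) ` run_ends N 1 \<sigma> \<subseteq> components N ?A"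
    by (auto simp: components_def quotient_def run_ends_def)
  moreover have "finite (components N ?A)"
    by (simp add: components_def quotient_def)
  ultimately show ?thesis
    unfolding plus_components_def by (rule card_inj_on_le)
qed

section \<open>Effect of one step\<close>

text \<open>Walking along the successors from \<open>i\<^sub>0\<close> never leaves the cluster, which therefore is everything.\<close>

lemma flip_cluster_constant:
  assumes "\<sigma> \<in> spin_configs N" and "\<sigma> \<in> {all_minus N, all_plus N}" and i\<^sub>0: "i\<^sub>0 \<in> {1..N}"
  shows "flip_cluster N \<sigma> i\<^sub>0 = spin_neg N \<sigma>"
proof -
  obtain s where s: "\<forall>i\<in>{1..N}. \<sigma> i = s"
    using assms constant_config_iff by blast
  have "i \<in> (same_spin_edges N \<sigma>)\<^sup>* `` {i\<^sub>0}" if "i \<in> {1..N}" for i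
    using i\<^sub>0 that
  proof (induction rule: cyclic_induct)
    case (step z)
    have "(z, cyclic_succ N z) \<in> same_spin_edges N \<sigma>"
      using s step.hyps cyclic_succ_in[of z N] edge_cyclic_succ[of z N]
      by (simp add: same_spin_edges_def)
    then show ?case
      using step.IH by (auto intro: rtrancl_into_rtrancl)
  qed simp
  then show ?thesis
    by (auto simp: flip_cluster_def spin_neg_def)
qed

lemma flip_cluster_in_spin_configs:
  assumes "\<sigma> \<in> spin_configs N"
  shows "flip_cluster N \<sigma> i\<^sub>0 \<in> spin_configs N"
  using assms by (fastforce simp: flip_cluster_def spin_configs_def PiE_iff)

text \<open>A flipped site no longer carries the cluster spin, so an end of the new configuration lies
  outside the cluster and had that spin before.  If its successor had been flipped, the two would
  have been joined by a same-spin edge, contradicting that the cluster is closed under such edges.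
  So every new end is an old one, and the end of the cluster is lost.  Ends of runs of the opposite
  spin are compared only through \<open>card_run_ends_eq\<close>.\<close>

lemma flip_run_ends_psubset:
  assumes \<sigma>: "\<sigma> \<in> spin_configs N" and nonconst: "\<sigma> \<notin> {all_minus N, all_plus N}"
    and i\<^sub>0: "i\<^sub>0 \<in> {1..N}"
  shows "run_ends N (\<sigma> i\<^sub>0) (flip_cluster N \<sigma> i\<^sub>0) \<subset> run_ends N (\<sigma> i\<^sub>0) \<sigma>"
proof
  let ?R = "same_spin_edges N \<sigma>"
  let ?C = "?R\<^sup>* `` {i\<^sub>0}"
  let ?\<tau> = "flip_cluster N \<sigma> i\<^sub>0"
  have spin: "\<sigma> i = 1 \<or> \<sigma> i = -1" if "i \<in> {1..N}" for i
    using spin_cases[OF \<sigma> that] .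
  have s: "\<sigma> i\<^sub>0 \<noteq> 0"
    using spin[OF i\<^sub>0] by auto
  have C_spin: "\<sigma> i = \<sigma> i\<^sub>0" if "i \<in> ?C" for i
    using that cluster_spin by auto
  have inside: "?\<tau> i = - \<sigma> i\<^sub>0" if "i \<in> {1..N}" "i \<in> ?C" for i
    using that C_spin[OF that(2)] by (simp add: flip_cluster_def)
  have outside: "?\<tau> i = \<sigma> i" if "i \<in> {1..N}" "i \<notin> ?C" for i
    using that by (simp add: flip_cluster_def)
  show "run_ends N (\<sigma> i\<^sub>0) ?\<tau> \<subseteq> run_ends N (\<sigma> i\<^sub>0) \<sigma>"
  proof
    fix i assume "i \<in> run_ends N (\<sigma> i\<^sub>0) ?\<tau>"
    then have i: "i \<in> {1..N}" "?\<tau> i = \<sigma> i\<^sub>0" "?\<tau> (cyclic_succ N i) \<noteq> \<sigma> i\<^sub>0"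
      by (auto simp: run_ends_def)
    let ?j = "cyclic_succ N i"
    have "i \<notin> ?C"
      using i inside[of i] s by auto
    then have \<sigma>i: "\<sigma> i = \<sigma> i\<^sub>0"
      using i outside[of i] by simp
    have "\<sigma> ?j \<noteq> \<sigma> i\<^sub>0"
    proof
      assume j: "\<sigma> ?j = \<sigma> i\<^sub>0"
      then have "?j \<in> ?C"
        using i outside[of ?j] cyclic_succ_in[of i N] by auto
      moreover have "(?j, i) \<in> ?R"
        using j \<sigma>i edge_cyclic_succ[OF i(1)] by (simp add: same_spin_edges_def insert_commute)
      ultimately have "i \<in> ?C"
        by (auto intro: rtrancl_into_rtrancl)
      with \<open>i \<notin> ?C\<close> show False ..
    qed
    with i \<sigma>i show "i \<in> run_ends N (\<sigma> i\<^sub>0) \<sigma>"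
      by (simp add: run_ends_def)
  qed
  \<comment> \<open>The cluster has an end: otherwise it would be closed under successors and fill the cycle.\<close>
  have "\<exists>i\<in>?C \<inter> {1..N}. \<sigma> (cyclic_succ N i) \<noteq> \<sigma> i\<^sub>0"
  proof (rule ccontr)
    assume no_end: "\<not> ?thesis"
    have "y \<in> ?C" if "y \<in> {1..N}" for y
      using i\<^sub>0 that
    proof (induction rule: cyclic_induct)
      case (step z)
      then have "(z, cyclic_succ N z) \<in> ?R"
        using no_end C_spin[of z] edge_cyclic_succ[of z N] by (auto simp: same_spin_edges_def)
      with step.IH show ?case
        by (auto intro: rtrancl_into_rtrancl)
    qed simp
    then have "\<forall>y\<in>{1..N}. \<sigma> y = \<sigma> i\<^sub>0"
      using C_spin by blast
    with nonconst show False
      unfolding constant_config_iff[OF \<sigma>] by blast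
  qed
  then obtain i where i: "i \<in> {1..N}" "i \<in> ?C" "\<sigma> (cyclic_succ N i) \<noteq> \<sigma> i\<^sub>0"
    by blast
  then have "i \<in> run_ends N (\<sigma> i\<^sub>0) \<sigma>"
    using C_spin[of i] by (simp add: run_ends_def)
  moreover have "i \<notin> run_ends N (\<sigma> i\<^sub>0) ?\<tau>"
    using i inside s by (simp add: run_ends_def)
  ultimately show "run_ends N (\<sigma> i\<^sub>0) ?\<tau> \<noteq> run_ends N (\<sigma> i\<^sub>0) \<sigma>"
    by blast
qed

text \<open>Subtraction on the naturals truncates, so this one inequality also says that the constant
  configurations, which have no run ends, are mapped to constant ones.\<close>

lemma card_run_ends_flip_cluster:
  assumes \<sigma>: "\<sigma> \<in> spin_configs N" and i\<^sub>0: "i\<^sub>0 \<in> {1..N}"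
  shows "card (run_ends N 1 (flip_cluster N \<sigma> i\<^sub>0)) \<le> card (run_ends N 1 \<sigma>) - 1"
proof (cases "\<sigma> \<in> {all_minus N, all_plus N}")
  case True
  then obtain s where "\<forall>i\<in>{1..N}. \<sigma> i = s"
    using \<sigma> constant_config_iff by blast
  then have "run_ends N 1 (spin_neg N \<sigma>) = {}"
    by (intro run_ends_constant[of _ _ "- s"]) (simp add: spin_neg_def)
  then show ?thesis
    using flip_cluster_constant[OF \<sigma> True i\<^sub>0] by simp
next
  case False
  let ?\<tau> = "flip_cluster N \<sigma> i\<^sub>0"
  have "card (run_ends N (\<sigma> i\<^sub>0) ?\<tau>) < card (run_ends N (\<sigma> i\<^sub>0) \<sigma>)"
    by (intro psubset_card_mono flip_run_ends_psubset \<sigma> i\<^sub>0 False finite_run_ends)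
  moreover have "\<sigma> i\<^sub>0 = 1 \<or> \<sigma> i\<^sub>0 = -1"
    by (rule spin_cases[OF \<sigma> i\<^sub>0])
  ultimately have "card (run_ends N 1 ?\<tau>) < card (run_ends N 1 \<sigma>)"
    using card_run_ends_eq[OF \<sigma>] card_run_ends_eq[OF flip_cluster_in_spin_configs[OF \<sigma>], of i\<^sub>0]
    by auto
  then show ?thesis by simp
qed

section \<open>Trajectories of a Markov chain\<close>

context markov_chain
begin

lemma state_in_S: "k \<ge> 1 \<Longrightarrow> \<omega> \<in> space M \<Longrightarrow> Y k \<omega> \<in> S"
  using random_state[of k] by (simp add: measurable_def Pi_iff)

lemma state_event:
  assumes "k \<ge> 1"
  shows "{\<omega> \<in> space M. Y k \<omega> \<in> A} \<in> events"
proof -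
  have "{\<omega> \<in> space M. Y k \<omega> \<in> A} = Y k -` (A \<inter> S) \<inter> space M"
    using state_in_S[OF assms] by auto
  also have "\<dots> \<in> events"
    using random_state[OF assms] by (rule measurable_sets) simp
  finally show ?thesis .
qed

lemma history_event: "{\<omega> \<in> space M. \<forall>i\<in>{1..k}. Y i \<omega> = x i} \<in> events"
  using state_event[of _ "{x _}"] by (intro sets.sets_Collect_finite_All) auto

text \<open>There are only countably many histories of a given length.  For each of them the Markov
  property gives a forbidden transition conditional probability zero, and a history that itself has
  probability zero contributes nothing.\<close>

lemma AE_transition:
  assumes S: "countable S" and k: "k \<ge> 1"
  shows "AE \<omega> in M. Y (k + 1) \<omega> \<in> set_pmf (K (Y k \<omega>))"
proof -
  let ?H = "\<lambda>x \<omega>. \<forall>i\<in>{1..k}. Y i \<omega> = x i"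
  have "AE \<omega> in M. \<not> (Y (k + 1) \<omega> = x (k + 1) \<and> ?H x \<omega>)"
    if forbidden: "x (k + 1) \<notin> set_pmf (K (x k))" for x
  proof -
    let ?E = "{\<omega> \<in> space M. Y (k + 1) \<omega> = x (k + 1) \<and> ?H x \<omega>}"
    have E: "?E \<in> events"
      using state_event[of "k + 1" "{x (k + 1)}"] history_event[of k x]
      by (intro sets.sets_Collect_conj) auto
    have "prob ?E = 0"
    proof (cases "\<P>(\<omega> in M. ?H x \<omega>) > 0")
      case True
      have "\<P>(\<omega> in M. Y (k + 1) \<omega> = x (k + 1) \<bar> ?H x \<omega>) = 0"
        using markov[OF k True] forbidden by (simp add: set_pmf_iff)
      with True show ?thesis
        by (simp add: cond_prob_def)
    next
      case False
      have "prob ?E \<le> \<P>(\<omega> in M. ?H x \<omega>)"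
        by (intro finite_measure_mono history_event) auto
      with False show ?thesis
        using measure_nonneg[of M ?E] by linarith
    qed
    with E have "AE \<omega> in M. \<omega> \<notin> ?E"
      by (simp add: prob_eq_0)
    with AE_space show ?thesis
      by eventually_elim auto
  qed
  then have "AE \<omega> in M. \<forall>x\<in>{1..k + 1} \<rightarrow>\<^sub>E S. x (k + 1) \<notin> set_pmf (K (x k)) \<longrightarrow>
      \<not> (Y (k + 1) \<omega> = x (k + 1) \<and> ?H x \<omega>)"
    using S by (subst AE_ball_countable) (auto intro!: countable_PiE)
  with AE_space show ?thesis
  proof eventually_elim
    case (elim \<omega>)
    \<comment> \<open>Restricting the trajectory to the times up to \<open>k + 1\<close> makes it one of the countably many
      histories.\<close>
    let ?x = "\<lambda>i\<in>{1..k + 1}. Y i \<omega>"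
    have "?x \<in> {1..k + 1} \<rightarrow>\<^sub>E S"
      using state_in_S elim(1) by auto
    then have "?x (k + 1) \<notin> set_pmf (K (?x k)) \<longrightarrow>
        \<not> (Y (k + 1) \<omega> = ?x (k + 1) \<and> ?H ?x \<omega>)"
      using elim(2) by blast
    then show ?case
      using k by auto
  qed
qed

lemma AE_transitions:
  assumes "countable S"
  shows "AE \<omega> in M. \<forall>k\<ge>1. Y k \<omega> \<in> S \<and> Y (k + 1) \<omega> \<in> set_pmf (K (Y k \<omega>))"
proof -
  have "AE \<omega> in M. \<forall>k. k \<ge> 1 \<longrightarrow> Y (k + 1) \<omega> \<in> set_pmf (K (Y k \<omega>))"
    using AE_transition[OF assms] by (simp add: AE_all_countable)
  with AE_space show ?thesis
    by eventually_elim (auto intro: state_in_S)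
qed

lemma cond_prob_eq_1:
  assumes "k \<ge> 1" and pos: "\<P>(\<omega> in M. Y 1 \<omega> = \<tau>) > 0"
    and ae: "AE \<omega> in M. Y 1 \<omega> = \<tau> \<longrightarrow> Y k \<omega> \<in> A"
  shows "\<P>(\<omega> in M. Y k \<omega> \<in> A \<bar> Y 1 \<omega> = \<tau>) = 1"
proof -
  have "\<P>(\<omega> in M. Y k \<omega> \<in> A \<and> Y 1 \<omega> = \<tau>) = \<P>(\<omega> in M. Y 1 \<omega> = \<tau>)"
  proof (rule finite_measure_eq_AE)
    show "AE \<omega> in M. (\<omega> \<in> {\<omega> \<in> space M. Y k \<omega> \<in> A \<and> Y 1 \<omega> = \<tau>}) =
        (\<omega> \<in> {\<omega> \<in> space M. Y 1 \<omega> = \<tau>})"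
      using ae by eventually_elim auto
    show "{\<omega> \<in> space M. Y k \<omega> \<in> A \<and> Y 1 \<omega> = \<tau>} \<in> events"
      using state_event[OF assms(1), of A] state_event[of 1 "{\<tau>}"]
      by (intro sets.sets_Collect_conj) auto
    show "{\<omega> \<in> space M. Y 1 \<omega> = \<tau>} \<in> events"
      using state_event[of 1 "{\<tau>}"] by simp
  qed
  with pos show ?thesis
    by (simp add: cond_prob_def)
qed

end

section \<open>Trajectories of the Wolff dynamics\<close>

text \<open>From here on the argument is deterministic: it applies to every trajectory all of whose
  transitions have positive probability.\<close>

locale wolff_trajectory =
  fixes N :: nat and y :: "nat \<Rightarrow> nat \<Rightarrow> int"
  assumes config: "k \<ge> 1 \<Longrightarrow> y k \<in> spin_configs N"
    and step: "k \<ge> 1 \<Longrightarrow> y (k + 1) \<in> flip_cluster N (y k) ` {1..N}"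
begin

lemma run_ends_decrease:
  assumes "k \<ge> 1"
  shows "card (run_ends N 1 (y (k + n))) \<le> card (run_ends N 1 (y k)) - n"
proof (induction n)
  case (Suc n)
  have "k + n \<ge> 1"
    using assms by simp
  then have "card (run_ends N 1 (y (k + n + 1))) \<le> card (run_ends N 1 (y (k + n))) - 1"
    using step[of "k + n"] config[of "k + n"] card_run_ends_flip_cluster by auto
  with Suc show ?case by simp
qed simp

lemma constant_iff_card:
  "k \<ge> 1 \<Longrightarrow> y k \<in> {all_minus N, all_plus N} \<longleftrightarrow> card (run_ends N 1 (y k)) = 0"
  using no_run_ends_iff_constant[OF config] by simp

text \<open>With the number of run ends of \<open>y k\<close> itself as \<open>n\<close> this gives absorption; larger \<open>n\<close> give
  the bound by plus components and, from zero run ends, permanence.\<close>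

lemma constant_after:
  assumes "k \<ge> 1" and "card (run_ends N 1 (y k)) \<le> n"
  shows "y (k + n) \<in> {all_minus N, all_plus N}"
  using constant_iff_card[of "k + n"] run_ends_decrease[OF assms(1), of n] assms by simp

lemma constant_stays:
  assumes "k \<ge> 1" and "y k \<in> {all_minus N, all_plus N}" and "k \<le> l"
  shows "y l \<in> {all_minus N, all_plus N}"
  using constant_after[of k "l - k"] constant_iff_card[of k] assms by simp

lemma constant_alternates:
  assumes const: "y 1 \<in> {all_minus N, all_plus N}" and "k \<ge> 1"
  shows "y k = (if odd k then y 1 else spin_neg N (y 1))"
  using assms(2)
proof (induction rule: nat_induct_at_least)
  case (Suc k)
  have "y k \<in> {all_minus N, all_plus N}"
    using constant_stays[OF _ const] Suc.hyps by simp
  then have "y (Suc k) = spin_neg N (y k)"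
    using step[OF Suc.hyps] config[OF Suc.hyps] flip_cluster_constant by auto
  moreover have "spin_neg N (spin_neg N (y 1)) = y 1"
    using const by (auto simp: spin_neg_def all_minus_def all_plus_def)
  ultimately show ?case
    using Suc.IH by simp
qed simp

end

theorem theorem3p5:
  fixes N :: nat and M :: "'w measure" and Y :: "nat \<Rightarrow> 'w \<Rightarrow> nat \<Rightarrow> int"
  assumes "N \<ge> 1" and "wolff_dynamics N \<infinity> M Y"
  shows "(AE \<omega> in M. \<exists>k\<ge>1. Y k \<omega> \<in> {all_minus N, all_plus N})
    \<and> (AE \<omega> in M. \<forall>k\<ge>1. Y k \<omega> \<in> {all_minus N, all_plus N} \<longrightarrow>
           (\<forall>l\<ge>k. Y l \<omega> \<in> {all_minus N, all_plus N}))
    \<and> (\<forall>k\<ge>1. AE \<omega> in M. Y 1 \<omega> \<in> {all_minus N, all_plus N} \<longrightarrow>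
           Y k \<omega> = (if odd k then Y 1 \<omega> else spin_neg N (Y 1 \<omega>)))
    \<and> (\<forall>\<tau>\<in>spin_configs N - {all_minus N, all_plus N}.
           \<P>(\<omega> in M. Y 1 \<omega> = \<tau>) > 0 \<longrightarrow>
           \<P>(\<omega> in M. Y (plus_components N \<tau> + 1) \<omega> \<in> {all_minus N, all_plus N}
              \<bar> Y 1 \<omega> = \<tau>) = 1)
    \<and> (\<forall>\<tau>\<in>spin_configs N - {all_minus N, all_plus N}.
           \<P>(\<omega> in M. Y 1 \<omega> = \<tau>) > 0 \<longrightarrow>
           (\<forall>k. \<P>(\<omega> in M. Y (plus_components N \<tau> + 1 + k) \<omega> \<in> {all_minus N, all_plus N}
              \<bar> Y 1 \<omega> = \<tau>) = 1))"
proof -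
  interpret markov_chain M "spin_configs N" "wolff_step N \<infinity>" Y
    using assms(2) by (simp add: wolff_dynamics_def)
  have "finite (spin_configs N)"
    by (simp add: spin_configs_def finite_PiE)
  then have traj: "AE \<omega> in M. wolff_trajectory N (\<lambda>k. Y k \<omega>)"
    using AE_transitions[OF countable_finite] set_pmf_wolff_step[OF assms(1)]
    by (simp add: wolff_trajectory_def all_conj_distrib imp_conjR)
  let ?const = "{all_minus N, all_plus N}"
  have hit: "AE \<omega> in M. Y 1 \<omega> = \<tau> \<longrightarrow> Y (plus_components N \<tau> + 1 + k) \<omega> \<in> ?const" for \<tau> k
    using traj
  proof eventually_elim
    case (elim \<omega>)
    interpret wolff_trajectory N "\<lambda>k. Y k \<omega>" by (fact elim)
    show ?case
      using constant_after[of 1 "plus_components N \<tau> + k"]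
        card_run_ends_le_plus_components[of N \<tau>] by auto
  qed
  have reach: "AE \<omega> in M. \<exists>k\<ge>1. Y k \<omega> \<in> ?const"
    using traj
  proof eventually_elim
    case (elim \<omega>)
    interpret wolff_trajectory N "\<lambda>k. Y k \<omega>" by (fact elim)
    show ?case
      using constant_after[of 1, OF _ order_refl] by (intro exI conjI) auto
  qed
  have stay: "AE \<omega> in M. \<forall>k\<ge>1. Y k \<omega> \<in> ?const \<longrightarrow> (\<forall>l\<ge>k. Y l \<omega> \<in> ?const)"
    using traj
  proof eventually_elim
    case (elim \<omega>)
    interpret wolff_trajectory N "\<lambda>k. Y k \<omega>" by (fact elim)
    show ?case
      using constant_stays by blast
  qed
  have alternate: "AE \<omega> in M. Y 1 \<omega> \<in> ?const \<longrightarrow>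
      Y k \<omega> = (if odd k then Y 1 \<omega> else spin_neg N (Y 1 \<omega>))" if "k \<ge> 1" for k
    using traj
  proof eventually_elim
    case (elim \<omega>)
    interpret wolff_trajectory N "\<lambda>k. Y k \<omega>" by (fact elim)
    show ?case
      using constant_alternates[OF _ that] by blast
  qed
  have hit_prob: "\<P>(\<omega> in M. Y (plus_components N \<tau> + 1 + k) \<omega> \<in> ?const \<bar> Y 1 \<omega> = \<tau>) = 1"
    if "\<P>(\<omega> in M. Y 1 \<omega> = \<tau>) > 0" for \<tau> k
    by (intro cond_prob_eq_1 that hit) simp
  show ?thesis
    using reach stay alternate hit_prob hit_prob[of _ 0] by auto
qed

end
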